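(* The Burgers equation $v_t+vv_x=v_{xx}$ admits no discrete point symmetry transformations; that is, its point symmetry group $G^{\rm B}$ is connected.
   Context: $G^{\rm B}$ is the Lie group of transformations $$\tilde t=\frac{\alpha t+\beta}{\gamma t+\delta},\quad \tilde x=\frac{x+\lambda_1t+\lambda_0}{\gamma t+\delta},\quad \tilde v=(\gamma t+\delta)v-\gamma x+\lambda_1\delta-\lambda_0\gamma,$$ with real parameters and $\alpha\delta-\beta\gamma=1$, each considered on its natural domain $\{(t,x,v)\in\mathbb R^3\mid\gamma t+\delta\ne0\}$. These are all the point symmetries of the Burgers equation. The multiplication is the modified composition: the product of $\Phi_1$ and $\Phi_2$ is the transformation of this form that has the same parameters as the usual composition $\Phi_1\circ\Phi_2$ and is considered on its natural domain. A discrete point symmetry is an element of $G^{\rm B}$ not belonging to its identity component. *)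

theory Defs
  imports "HOL-Analysis.Analysis" "HOL-Algebra.Group"
begin

text \<open>
  A point transformation is a partial map of the space of \<open>(t, x, v)\<close>, represented by a map
  whose domain is the natural domain of the transformation. A parameter tuple is
  \<open>(\<alpha>, \<beta>, \<gamma>, \<delta>, \<lambda>1, \<lambda>0)\<close>.
\<close>

type_synonym point = "real \<times> real \<times> real"
type_synonym point_transf = "point \<rightharpoonup> point"
type_synonym params = "real \<times> real \<times> real \<times> real \<times> real \<times> real"

definition GB_params :: "params set" where
  "GB_params = {(\<alpha>, \<beta>, \<gamma>, \<delta>, l1, l0). \<alpha> * \<delta> - \<beta> * \<gamma> = 1}"

definition GB_transf :: "params \<Rightarrow> point_transf" where
  "GB_transf = (\<lambda>(\<alpha>, \<beta>, \<gamma>, \<delta>, l1, l0) (t, x, v).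
     if \<gamma> * t + \<delta> \<noteq> 0
     then Some ((\<alpha> * t + \<beta>) / (\<gamma> * t + \<delta>),
                (x + l1 * t + l0) / (\<gamma> * t + \<delta>),
                (\<gamma> * t + \<delta>) * v - \<gamma> * x + l1 * \<delta> - l0 * \<gamma>)
     else None)"

definition GB_carrier :: "point_transf set" where
  "GB_carrier = GB_transf ` GB_params"

text \<open>
  The domain of the usual composition \<open>\<Phi>1 \<circ>\<^sub>m \<Phi>2\<close> may be smaller than the natural domain. The
  modified composition is its unique extension to a transformation of the group, see
  \<open>GB_mult_transf\<close> below.
\<close>

definition GB_mult :: "point_transf \<Rightarrow> point_transf \<Rightarrow> point_transf" where
  "GB_mult \<Phi>1 \<Phi>2 = (THE \<Phi>. \<Phi> \<in> GB_carrier \<and> (\<Phi>1 \<circ>\<^sub>m \<Phi>2) \<subseteq>\<^sub>m \<Phi>)"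

definition GB :: "point_transf monoid" where
  "GB = \<lparr>carrier = GB_carrier, mult = GB_mult, one = Some\<rparr>"

text \<open>
  The Lie group topology is the one transported from the parameter space, a closed
  submanifold of the six-dimensional real space, along the bijective parametrization.
\<close>

definition GB_topology :: "point_transf topology" where
  "GB_topology = topology (\<lambda>U. U \<subseteq> carrier GB \<and>
     openin (top_of_set GB_params) {p \<in> GB_params. GB_transf p \<in> U})"

definition discrete_point_symmetry :: "point_transf \<Rightarrow> bool" where
  "discrete_point_symmetry \<Phi> \<longleftrightarrow>
     \<Phi> \<in> carrier GB \<and> \<Phi> \<notin> connected_component_of_set GB_topology \<one>\<^bsub>GB\<^esub>"


subsection \<open>Well-definedness\<close>

lemma affine_eqI:
  fixes a b c d :: real
  assumes "finite F" "\<And>t. t \<notin> F \<Longrightarrow> a * t + b = c * t + d"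
  shows "a = c \<and> b = d"
proof -
  obtain s where s: "s \<notin> F"
    using ex_new_if_finite[OF infinite_UNIV_char_0 assms(1)] by blast
  have "finite (insert s F)" using assms(1) by simp
  then obtain r where r: "r \<notin> insert s F"
    using ex_new_if_finite[OF infinite_UNIV_char_0] by blast
  have e: "a * s + b = c * s + d" "a * r + b = c * r + d" using assms(2) s r by auto
  then have "(a - c) * (s - r) = 0" by (simp add: algebra_simps)
  then have "a = c" using r by simp
  then show ?thesis using e by simp
qed

lemma finite_pole:
  fixes c d :: real
  assumes "(c, d) \<noteq> (0, 0)"
  shows "finite {t. c * t + d = 0}"
proof (cases "c = 0")
  case True
  then show ?thesis using assms by simp
next
  case False
  have "t = - d / c" if "c * t + d = 0" for t
  proof -
    have "t * c = - d" using that by (simp add: mult.commute eq_neg_iff_add_eq_0)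
    then show ?thesis using False by (rule eq_divide_imp[rotated])
  qed
  then have "{t. c * t + d = 0} \<subseteq> {- d / c}" by blast
  then show ?thesis by (rule finite_subset) simp
qed

lemma GB_transf_determined:
  assumes p: "p \<in> GB_params" and q: "q \<in> GB_params" and "finite F"
    and eq: "\<And>t x v. t \<notin> F \<Longrightarrow> GB_transf p (t, x, v) = GB_transf q (t, x, v)"
  shows "p = q"
proof -
  obtain a b c d m n where p': "p = (a, b, c, d, m, n)" by (cases p) auto
  obtain a' b' c' d' m' n' where q': "q = (a', b', c', d', m', n')" by (cases q) auto
  have det: "a * d - b * c = 1" "a' * d' - b' * c' = 1"
    using p q by (auto simp: p' q' GB_params_def)
  define H where "H = F \<union> {t. c * t + d = 0} \<union> {t. c' * t + d' = 0}"
  have "(c, d) \<noteq> (0, 0)" "(c', d') \<noteq> (0, 0)" using det by auto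
  then have fin: "finite H" using \<open>finite F\<close> finite_pole by (auto simp: H_def)
  have E: "(a * t + b) / (c * t + d) = (a' * t + b') / (c' * t + d') \<and>
      (x + m * t + n) / (c * t + d) = (x + m' * t + n') / (c' * t + d')"
    if "t \<notin> H" for t x
    using eq[of t x 0] that by (auto simp: p' q' GB_transf_def H_def)
  have D: "c * t + d = c' * t + d'" if "t \<notin> H" for t
  proof -
    have "(1 + m * t + n) / (c * t + d) - (0 + m * t + n) / (c * t + d)
        = (1 + m' * t + n') / (c' * t + d') - (0 + m' * t + n') / (c' * t + d')"
      using E[OF that, of 1] E[OF that, of 0] by simp
    then have "1 / (c * t + d) = 1 / (c' * t + d')" by (simp add: diff_divide_distrib [symmetric])
    then show ?thesis by simp
  qed
  have A: "a * t + b = a' * t + b'" "m * t + n = m' * t + n'" if "t \<notin> H" for t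
  proof -
    have nz: "c * t + d \<noteq> 0" "c' * t + d' \<noteq> 0" using that by (auto simp: H_def)
    show "a * t + b = a' * t + b'" using E[OF that] D[OF that] nz by simp
    show "m * t + n = m' * t + n'" using E[OF that, of 0] D[OF that] nz by simp
  qed
  show ?thesis
    using affine_eqI[OF fin D] affine_eqI[OF fin A(1)] affine_eqI[OF fin A(2)]
    by (auto simp: p' q')
qed

lemma inj_on_GB_transf: "inj_on GB_transf GB_params"
  by (rule inj_onI) (rule GB_transf_determined[of _ _ "{}"]; simp)

definition GB_param_mult :: "params \<Rightarrow> params \<Rightarrow> params" where
  "GB_param_mult = (\<lambda>(a1, b1, c1, d1, m1, n1) (a2, b2, c2, d2, m2, n2).
     (a1 * a2 + b1 * c2, a1 * b2 + b1 * d2, c1 * a2 + d1 * c2, c1 * b2 + d1 * d2,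
      m2 + m1 * a2 + n1 * c2, n2 + m1 * b2 + n1 * d2))"

lemma GB_param_mult_closed:
  assumes "p \<in> GB_params" "q \<in> GB_params"
  shows "GB_param_mult p q \<in> GB_params"
proof -
  obtain a b c d m n where p': "p = (a, b, c, d, m, n)" by (cases p) auto
  obtain a' b' c' d' m' n' where q': "q = (a', b', c', d', m', n')" by (cases q) auto
  have "(a * a' + b * c') * (c * b' + d * d') - (a * b' + b * d') * (c * a' + d * c')
      = (a * d - b * c) * (a' * d' - b' * c')" by (simp add: algebra_simps)
  then show ?thesis using assms by (auto simp: p' q' GB_params_def GB_param_mult_def)
qed

lemma GB_transf_comp:
  assumes "p \<in> GB_params" "q \<in> GB_params"
  shows "(GB_transf p \<circ>\<^sub>m GB_transf q) \<subseteq>\<^sub>m GB_transf (GB_param_mult p q)"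
    and "\<exists>F. finite F \<and> (\<forall>t x v. t \<notin> F \<longrightarrow> (t, x, v) \<in> dom (GB_transf p \<circ>\<^sub>m GB_transf q))"
proof -
  obtain a b c d m n where p': "p = (a, b, c, d, m, n)" by (cases p) auto
  obtain a' b' c' d' m' n' where q': "q = (a', b', c', d', m', n')" by (cases q) auto
  have det: "a * d - b * c = 1" "a' * d' - b' * c' = 1"
    using assms by (auto simp: p' q' GB_params_def)
  define A B where "A t = a' * t + b'" and "B t = c' * t + d'" for t
  define D where "D t = (c * a' + d * c') * t + (c * b' + d * d')" for t
  have D: "D t = c * A t + d * B t" for t by (simp add: D_def A_def B_def algebra_simps)
  have quot: "c * (A t / B t) + d = D t / B t" if "B t \<noteq> 0" for t
    using that by (simp add: D field_simps)
  have comp: "(GB_transf p \<circ>\<^sub>m GB_transf q) (t, x, v) =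
      (if B t \<noteq> 0 \<and> D t \<noteq> 0 then GB_transf (GB_param_mult p q) (t, x, v) else None)" for t x v
  proof (cases "B t \<noteq> 0 \<and> D t \<noteq> 0")
    case False
    then show ?thesis
      using quot[of t]
      by (auto simp: p' q' map_comp_def GB_transf_def A_def[symmetric] B_def[symmetric])
  next
    case True
    then have B: "B t \<noteq> 0" and Dn: "D t \<noteq> 0" by auto
    define X where "X = (x + m' * t + n') / B t"
    define V where "V = B t * v - c' * x + m' * d' - n' * c'"
    have 1: "GB_transf q (t, x, v) = Some (A t / B t, X, V)"
      using B by (simp add: q' GB_transf_def A_def B_def X_def V_def)
    have 2: "GB_transf p (A t / B t, X, V) =
        Some ((a * (A t / B t) + b) / (D t / B t), (X + m * (A t / B t) + n) / (D t / B t),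
          D t / B t * V - c * X + m * d - n * c)"
      using B Dn quot[OF B] by (simp add: p' GB_transf_def)
    have 3: "GB_transf (GB_param_mult p q) (t, x, v) =
       Some ((a * A t + b * B t) / D t, (x + (m' * t + n') + m * A t + n * B t) / D t,
         D t * v - (c * a' + d * c') * x
           + (m' + m * a' + n * c') * (c * b' + d * d') - (n' + m * b' + n * d') * (c * a' + d * c'))"
      using Dn by (simp add: p' q' GB_transf_def GB_param_mult_def D_def A_def B_def algebra_simps)
    have t: "(a * (A t / B t) + b) / (D t / B t) = (a * A t + b * B t) / D t"
      using B Dn by (simp add: field_simps)
    have x: "(X + m * (A t / B t) + n) / (D t / B t) = (x + (m' * t + n') + m * A t + n * B t) / D t"
      using B Dn by (simp add: X_def field_simps)
    have k: "D t * c' + c = B t * (c * a' + d * c')"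
    proof -
      have "D t * c' + c * (a' * d' - b' * c') = B t * (c * a' + d * c')"
        by (simp add: D_def B_def algebra_simps)
      then show ?thesis using det by simp
    qed
    have l: "D t * (m' * d' - n' * c') - c * (m' * t + n')
        = B t * (m' * (c * b' + d * d') - n' * (c * a' + d * c'))"
    proof -
      have "D t * (m' * d' - n' * c') - c * (m' * t + n') * (a' * d' - b' * c')
        = B t * (m' * (c * b' + d * d') - n' * (c * a' + d * c'))"
        by (simp add: D_def B_def algebra_simps)
      then show ?thesis using det by simp
    qed
    have r: "(m * a' + n * c') * (c * b' + d * d') - (m * b' + n * d') * (c * a' + d * c')
        = m * d - n * c"
    proof -
      have "(m * a' + n * c') * (c * b' + d * d') - (m * b' + n * d') * (c * a' + d * c')
        = (m * d - n * c) * (a' * d' - b' * c')" by (simp add: algebra_simps)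
      then show ?thesis using det by simp
    qed
    have "B t * (D t / B t * V - c * X) = D t * V - c * (x + m' * t + n')"
      using B by (simp add: X_def field_simps)
    also have "\<dots> = B t * (D t * v) - (D t * c' + c) * x
        + (D t * (m' * d' - n' * c') - c * (m' * t + n'))"
      by (simp add: V_def algebra_simps)
    also have "\<dots> = B t * (D t * v - (c * a' + d * c') * x
        + (m' * (c * b' + d * d') - n' * (c * a' + d * c')))"
      unfolding k l by (simp add: algebra_simps)
    finally have "D t / B t * V - c * X = D t * v - (c * a' + d * c') * x
        + (m' * (c * b' + d * d') - n' * (c * a' + d * c'))"
      using B mult_left_cancel by blast
    then have v: "D t / B t * V - c * X + m * d - n * c = D t * v - (c * a' + d * c') * x
           + (m' + m * a' + n * c') * (c * b' + d * d') - (n' + m * b' + n * d') * (c * a' + d * c')"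
      using r by (simp add: algebra_simps)
    have "(GB_transf p \<circ>\<^sub>m GB_transf q) (t, x, v) = GB_transf (GB_param_mult p q) (t, x, v)"
      unfolding 3 by (simp only: map_comp_def 1 option.case 2 t x v)
    then show ?thesis using True by simp
  qed
  show "(GB_transf p \<circ>\<^sub>m GB_transf q) \<subseteq>\<^sub>m GB_transf (GB_param_mult p q)"
    unfolding map_le_def by (auto simp: comp split: if_splits)
  have "(a * a' + b * c') * (c * b' + d * d') - (a * b' + b * d') * (c * a' + d * c') = 1"
    using GB_param_mult_closed[OF assms] unfolding p' q' GB_params_def GB_param_mult_def by simp
  then have "(c * a' + d * c', c * b' + d * d') \<noteq> (0, 0)" by force
  moreover have "(c', d') \<noteq> (0, 0)" using det by auto
  ultimately have "finite ({t. B t = 0} \<union> {t. D t = 0})"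
    by (simp add: B_def D_def finite_pole)
  moreover have "(t, x, v) \<in> dom (GB_transf p \<circ>\<^sub>m GB_transf q)"
    if "t \<notin> {t. B t = 0} \<union> {t. D t = 0}" for t x v
  proof -
    have "GB_transf (GB_param_mult p q) (t, x, v) \<noteq> None"
      using that unfolding p' q' GB_transf_def GB_param_mult_def D_def by simp
    then show ?thesis using that by (simp add: dom_def comp)
  qed
  ultimately show "\<exists>F. finite F \<and>
      (\<forall>t x v. t \<notin> F \<longrightarrow> (t, x, v) \<in> dom (GB_transf p \<circ>\<^sub>m GB_transf q))"
    by blast
qed

lemma GB_mult_transf:
  assumes p: "p \<in> GB_params" and q: "q \<in> GB_params"
  shows "GB_mult (GB_transf p) (GB_transf q) = GB_transf (GB_param_mult p q)"
  unfolding GB_mult_def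
proof (rule the_equality)
  note r = GB_param_mult_closed[OF p q]
  show "GB_transf (GB_param_mult p q) \<in> GB_carrier \<and>
      (GB_transf p \<circ>\<^sub>m GB_transf q) \<subseteq>\<^sub>m GB_transf (GB_param_mult p q)"
    using GB_transf_comp(1)[OF p q] r by (auto simp: GB_carrier_def)
  fix \<Phi> assume \<Phi>: "\<Phi> \<in> GB_carrier \<and> (GB_transf p \<circ>\<^sub>m GB_transf q) \<subseteq>\<^sub>m \<Phi>"
  then obtain s where s: "s \<in> GB_params" "\<Phi> = GB_transf s" by (auto simp: GB_carrier_def)
  obtain F where F: "finite F"
    "\<And>t x v. t \<notin> F \<Longrightarrow> (t, x, v) \<in> dom (GB_transf p \<circ>\<^sub>m GB_transf q)"
    using GB_transf_comp(2)[OF p q] by blast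
  have "s = GB_param_mult p q"
  proof (rule GB_transf_determined[OF s(1) r F(1)])
    fix t x v :: real
    assume "t \<notin> F"
    then have "(t, x, v) \<in> dom (GB_transf p \<circ>\<^sub>m GB_transf q)" by (rule F(2))
    then have "(GB_transf p \<circ>\<^sub>m GB_transf q) (t, x, v) = GB_transf s (t, x, v)"
      "(GB_transf p \<circ>\<^sub>m GB_transf q) (t, x, v) = GB_transf (GB_param_mult p q) (t, x, v)"
      using \<Phi> GB_transf_comp(1)[OF p q] unfolding s(2) map_le_def by blast+
    then show "GB_transf s (t, x, v) = GB_transf (GB_param_mult p q) (t, x, v)" by simp
  qed
  then show "\<Phi> = GB_transf (GB_param_mult p q)" using s by simp
qed

lemma GB_one_transf: "Some = GB_transf (1, 0, 0, 1, 0, 0)"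
  by (auto simp: GB_transf_def fun_eq_iff)

lemma group_GB: "group GB"
proof (rule groupI)
  have C: "carrier GB = GB_transf ` GB_params" by (simp add: GB_def GB_carrier_def)
  have M: "GB_transf p \<otimes>\<^bsub>GB\<^esub> GB_transf q = GB_transf (GB_param_mult p q)"
    if "p \<in> GB_params" "q \<in> GB_params" for p q
    using GB_mult_transf[OF that] by (simp add: GB_def)
  have I: "\<one>\<^bsub>GB\<^esub> = GB_transf (1, 0, 0, 1, 0, 0)" "(1, 0, 0, 1, 0, 0) \<in> GB_params"
    by (auto simp: GB_def GB_one_transf GB_params_def)
  show "x \<otimes>\<^bsub>GB\<^esub> y \<in> carrier GB" if "x \<in> carrier GB" "y \<in> carrier GB" for x y
    using that by (auto simp: C M GB_param_mult_closed)
  show "\<one>\<^bsub>GB\<^esub> \<in> carrier GB" using I by (auto simp: C)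
  have assoc: "GB_param_mult (GB_param_mult p q) r = GB_param_mult p (GB_param_mult q r)" for p q r
    by (cases p, cases q, cases r) (auto simp: GB_param_mult_def algebra_simps)
  show "x \<otimes>\<^bsub>GB\<^esub> y \<otimes>\<^bsub>GB\<^esub> z = x \<otimes>\<^bsub>GB\<^esub> (y \<otimes>\<^bsub>GB\<^esub> z)"
    if "x \<in> carrier GB" "y \<in> carrier GB" "z \<in> carrier GB" for x y z
    using that by (auto simp: C M GB_param_mult_closed assoc)
  show "\<one>\<^bsub>GB\<^esub> \<otimes>\<^bsub>GB\<^esub> x = x" if x: "x \<in> carrier GB" for x
  proof -
    obtain p where "p \<in> GB_params" "x = GB_transf p" using x by (auto simp: C)
    moreover have "GB_param_mult (1, 0, 0, 1, 0, 0) p = p"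
      by (cases p) (auto simp: GB_param_mult_def)
    ultimately show ?thesis using M[OF I(2)] by (simp add: I(1))
  qed
  show "\<exists>y\<in>carrier GB. y \<otimes>\<^bsub>GB\<^esub> x = \<one>\<^bsub>GB\<^esub>" if x: "x \<in> carrier GB" for x
  proof -
    obtain a b c d m n where p: "(a, b, c, d, m, n) \<in> GB_params" "x = GB_transf (a, b, c, d, m, n)"
      using x by (auto simp: C)
    have det: "a * d - b * c = 1" using p by (simp add: GB_params_def)
    let ?i = "(d, - b, - c, a, c * n - d * m, b * m - a * n)"
    have i: "?i \<in> GB_params" using det by (simp add: GB_params_def algebra_simps)
    have e: "(c * n - d * m) * a + (b * m - a * n) * c = - m * (a * d - b * c)"
      "(c * n - d * m) * b + (b * m - a * n) * d = - n * (a * d - b * c)"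
      by (simp_all add: algebra_simps)
    have "GB_param_mult ?i (a, b, c, d, m, n) = (1, 0, 0, 1, 0, 0)"
      using e[unfolded det] det by (simp add: GB_param_mult_def algebra_simps)
    then show ?thesis using M[OF i p(1)] i p(2) I(1) by (auto simp: C)
  qed
qed

lemma openin_GB_topology:
  "openin GB_topology U \<longleftrightarrow> U \<subseteq> carrier GB \<and>
     openin (top_of_set GB_params) {p \<in> GB_params. GB_transf p \<in> U}"
proof -
  let ?P = "\<lambda>U. {p \<in> GB_params. GB_transf p \<in> U}"
  have 1: "?P (S \<inter> T) = ?P S \<inter> ?P T" for S T by auto
  have 2: "?P (\<Union>\<K>) = \<Union> (?P ` \<K>)" for \<K> by auto
  have "istopology (\<lambda>U. U \<subseteq> carrier GB \<and> openin (top_of_set GB_params) (?P U))"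
    unfolding istopology_def 1 2 by (auto intro!: openin_Int openin_Union)
  then show ?thesis unfolding GB_topology_def by (simp add: topology_inverse')
qed

lemma topspace_GB_topology: "topspace GB_topology = carrier GB"
proof
  show "topspace GB_topology \<subseteq> carrier GB"
    unfolding topspace_def by (auto simp: openin_GB_topology)
  have "{p \<in> GB_params. GB_transf p \<in> carrier GB} = GB_params"
    by (auto simp: GB_def GB_carrier_def)
  then have "openin GB_topology (carrier GB)" unfolding openin_GB_topology by simp
  then show "carrier GB \<subseteq> topspace GB_topology" by (rule openin_subset)
qed

lemma homeomorphic_map_GB_transf:
  "homeomorphic_map (top_of_set GB_params) GB_topology GB_transf"
  unfolding homeomorphic_map_def quotient_map_def
  using inj_on_GB_transf
  by (auto simp: topspace_GB_topology openin_GB_topology GB_def GB_carrier_def)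

end

(* A matrix of determinant 1 is given by its first column w, an arbitrary nonzero vector of the
   plane, and the component of its second column along w. So the parameter space is a continuous
   image of the punctured plane times a vector space. *)
theory Submission
  imports Defs
begin

text \<open>In the orthogonal basis \<open>(a, c)\<close>, \<open>(-c, a)\<close> of the plane, the
  second column \<open>(b, d)\<close> has the determinant divided by
  \<open>a\<^sup>2 + c\<^sup>2\<close> as its coefficient along \<open>(-c, a)\<close>. Determinant
  1 therefore fixes this coefficient and leaves the other one, \<open>u\<close>, free.\<close>

lemma GB_params_eq_image:
  "GB_params = (\<lambda>((a, c), u, m, n).
     (a, u * a - c / (a\<^sup>2 + c\<^sup>2), c, u * c + a / (a\<^sup>2 + c\<^sup>2), m, n)) ` ((- {(0, 0)}) \<times> UNIV)"
  (is "_ = ?f ` _")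
proof
  show "GB_params \<subseteq> ?f ` ((- {(0, 0)}) \<times> UNIV)"
  proof
    fix p assume p: "p \<in> GB_params"
    obtain a b c d m n where p': "p = (a, b, c, d, m, n)" by (cases p) auto
    have det: "a * d - b * c = 1" using p by (simp add: p' GB_params_def)
    then have nz: "(a, c) \<noteq> (0, 0)" by auto
    then have q: "a\<^sup>2 + c\<^sup>2 \<noteq> 0" by (simp add: sum_power2_eq_zero_iff)
    \<comment> \<open>The coefficient of the orthogonal projection of \<open>(b, d)\<close> onto
      \<open>(a, c)\<close>.\<close>
    define u where "u = (a * b + c * d) / (a\<^sup>2 + c\<^sup>2)"
    \<comment> \<open>With the determinant kept as a factor, both are polynomial identities; its
      value 1 enters only afterwards.\<close>
    have "(a * b + c * d) * a - c * (a * d - b * c) = b * (a\<^sup>2 + c\<^sup>2)"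
      "(a * b + c * d) * c + a * (a * d - b * c) = d * (a\<^sup>2 + c\<^sup>2)"
      by (simp_all add: algebra_simps power2_eq_square)
    then have "(a * b + c * d) * a - c = b * (a\<^sup>2 + c\<^sup>2)" "(a * b + c * d) * c + a = d * (a\<^sup>2 + c\<^sup>2)"
      by (simp_all add: det)
    then have "u * a - c / (a\<^sup>2 + c\<^sup>2) = b" "u * c + a / (a\<^sup>2 + c\<^sup>2) = d"
      using q by (simp_all add: u_def divide_eq_eq
          flip: diff_divide_distrib add_divide_distrib)
    then have "p = ?f ((a, c), u, m, n)" by (simp add: p')
    then show "p \<in> ?f ` ((- {(0, 0)}) \<times> UNIV)" using nz by blast
  qed
  show "?f ` ((- {(0, 0)}) \<times> UNIV) \<subseteq> GB_params"
  proof (rule image_subsetI)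
    fix y :: "(real \<times> real) \<times> real \<times> real \<times> real"
    assume "y \<in> (- {(0, 0)}) \<times> UNIV"
    then obtain a c u m n where y: "y = ((a, c), u, m, n)" and "(a, c) \<noteq> (0, 0)"
      by (cases y) auto
    then have q: "a\<^sup>2 + c\<^sup>2 \<noteq> 0" by (simp add: sum_power2_eq_zero_iff)
    \<comment> \<open>An arbitrary \<open>r\<close> in place of \<open>a\<^sup>2 + c\<^sup>2\<close>
      keeps the denominator atomic. The terms in \<open>u\<close> cancel.\<close>
    have "a * (u * c + a / r) - (u * a - c / r) * c = (a\<^sup>2 + c\<^sup>2) / r" for r
      by (simp add: algebra_simps power2_eq_square add_divide_distrib)
    from this[of "a\<^sup>2 + c\<^sup>2"]
    show "?f y \<in> GB_params"
      using q by (simp add: y GB_params_def)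
  qed
qed

lemma connected_GB_params: "connected GB_params"
  unfolding GB_params_eq_image
proof (rule connected_continuous_image)
  show "connected ((- {(0, 0)} :: (real \<times> real) set) \<times> (UNIV :: (real \<times> real \<times> real) set))"
    \<comment> \<open>The remaining goal is that the plane has dimension at least 2; a punctured
      line would be disconnected.\<close>
    by (intro connected_Times connected_punctured_universe connected_UNIV) simp
  show "continuous_on ((- {(0, 0)}) \<times> UNIV) (\<lambda>((a, c), u, m, n).
      (a, u * a - c / (a\<^sup>2 + c\<^sup>2), c, u * c + a / (a\<^sup>2 + c\<^sup>2), m, n :: real) :: params)"
    unfolding case_prod_unfold
    \<comment> \<open>The side conditions say that the denominator vanishes only at the removed
      origin.\<close>
    by (intro continuous_intros) (auto simp: sum_power2_eq_zero_iff prod_eq_iff)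
qed

theorem corollary23:
  shows "(\<nexists>\<Phi>. discrete_point_symmetry \<Phi>) \<and> connected_space GB_topology"
proof
  have "connected_space (top_of_set GB_params)"
    using connected_GB_params by (simp add: connected_space_subtopology)
  then show conn: "connected_space GB_topology"
    using homeomorphic_map_GB_transf homeomorphic_map_imp_homeomorphic_space
      homeomorphic_connected_space by blast
  \<comment> \<open>In a connected space the component of a point is the whole space only if the
    point lies in that space.\<close>
  have "\<one>\<^bsub>GB\<^esub> \<in> carrier GB"
    using group_GB by (simp add: group.is_monoid monoid.one_closed)
  then have "connected_component_of_set GB_topology \<one>\<^bsub>GB\<^esub> = carrier GB"
    using conn unfolding connected_space_connected_component_set topspace_GB_topology by blast
  then show "\<nexists>\<Phi>. discrete_point_symmetry \<Phi>"
    by (simp add: discrete_point_symmetry_def)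
qed

end
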